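(* Let $f$ be a non-negative monotone submodular function and $C>1$. The MSbM Algorithm (described in the context) run with $q=1$ and parameter $C$ outputs a $b$-matching $M$ satisfying $$\left(2C+\frac{C}{C-1}\right)f(M)\ge f(OPT),$$ where $OPT$ is a maximum-value $b$-matching. Taking $C=1+\frac{1}{\sqrt2}$ this gives a $(3+2\sqrt2)\approx5.828$ approximation.
   Context: Setting: $G=(V,E)$ is a graph, $b\in\mathbb{Z}_{>0}^V$, and $f:2^E\to\mathbb{R}_{\ge0}$ is given by a value oracle. A $b$-matching is a set of edges in which each vertex $v$ has degree at most $b_v$. Edges arrive in a stream $e^{(1)},\dots,e^{(|E|)}$; write $e<e'$ if $e$ arrives before $e'$. Let $f_S(e)=f(S\cup\{e\})-f(S)$ and $f(e:S)=f_{S\cap\{e'<e\}}(e)$. MSbM Algorithm with parameters $C>0$, $q\in[0,1]$: Initialize an empty stack $S$ and potentials $\phi_v^{(0)}=0$. For $t=1,\dots,|E|$: let $e=e^{(t)}$ and set $\phi^{(t)}_v=\phi^{(t-1)}_v$ for all $v$. If $C\sum_{v\in e}\phi^{(t-1)}_v\ge f(e:S)$, skip $e$. Otherwise, with probability $q$, push $e$ onto $S$ and for each $v\in e$ set $w_{ev}=\big(f(e:S)-\sum_{u\in e}\phi^{(t-1)}_u\big)/b_v$ and $\phi^{(t)}_v=\phi^{(t-1)}_v+w_{ev}$. Post-processing: set $M=\emptyset$; pop the edges of $S$ (last pushed first), adding a popped edge $e$ to $M$ if every $v\in e$ has fewer than $b_v$ edges of $M$ incident to it. Output $M$. *)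

theory Defs
  imports "HOL-Probability.Probability_Mass_Function"
begin

definition simple_graph :: "'v set \<Rightarrow> 'v set set \<Rightarrow> bool" where
  "simple_graph V E \<longleftrightarrow> finite V \<and> (\<forall>e\<in>E. e \<subseteq> V \<and> card e = 2)"

definition edge_degree :: "'v set set \<Rightarrow> 'v \<Rightarrow> nat" where
  "edge_degree M v = card {e \<in> M. v \<in> e}"

definition b_matching :: "'v set \<Rightarrow> 'v set set \<Rightarrow> ('v \<Rightarrow> nat) \<Rightarrow> 'v set set \<Rightarrow> bool" where
  "b_matching V E b M \<longleftrightarrow> M \<subseteq> E \<and> (\<forall>v\<in>V. edge_degree M v \<le> b v)"

definition max_b_matching ::
    "('v set set \<Rightarrow> real) \<Rightarrow> 'v set \<Rightarrow> 'v set set \<Rightarrow> ('v \<Rightarrow> nat) \<Rightarrow> 'v set set \<Rightarrow> bool" where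
  "max_b_matching f V E b M \<longleftrightarrow>
     b_matching V E b M \<and> (\<forall>M'. b_matching V E b M' \<longrightarrow> f M' \<le> f M)"

definition marginal :: "('e set \<Rightarrow> real) \<Rightarrow> 'e set \<Rightarrow> 'e \<Rightarrow> real" where
  "marginal f S e = f (S \<union> {e}) - f S"

definition submodular_on :: "'e set \<Rightarrow> ('e set \<Rightarrow> real) \<Rightarrow> bool" where
  "submodular_on E f \<longleftrightarrow>
     (\<forall>S T e. S \<subseteq> T \<and> T \<subseteq> E \<and> e \<in> E - T \<longrightarrow> marginal f T e \<le> marginal f S e)"

definition edge_stream :: "'e set \<Rightarrow> 'e list \<Rightarrow> bool" where
  "edge_stream E es \<longleftrightarrow> distinct es \<and> set es = E"

definition arrives_before :: "'e list \<Rightarrow> 'e \<Rightarrow> 'e \<Rightarrow> bool" where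
  "arrives_before es e e' \<longleftrightarrow> (\<exists>i j. i < j \<and> j < length es \<and> es ! i = e \<and> es ! j = e')"

text \<open>The quantity written \<open>f(e : S)\<close>.\<close>

definition stream_marginal :: "('e set \<Rightarrow> real) \<Rightarrow> 'e list \<Rightarrow> 'e \<Rightarrow> 'e set \<Rightarrow> real" where
  "stream_marginal f es e S = marginal f (S \<inter> {e'. arrives_before es e' e}) e"

text \<open>
  A state of the streaming phase is a pair of the stack, with the most recently pushed edge at the
  head of the list, and the vertex potentials.
\<close>

type_synonym 'v msbm_state = "'v set list \<times> ('v \<Rightarrow> real)"

definition msbm_push ::
    "('v set set \<Rightarrow> real) \<Rightarrow> ('v \<Rightarrow> nat) \<Rightarrow> 'v set list \<Rightarrow> 'v set \<Rightarrow> 'v msbm_state \<Rightarrow> 'v msbm_state"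
  where
  "msbm_push f b es e = (\<lambda>(S, \<phi>).
     let w = (\<lambda>v. (stream_marginal f es e (set S) - (\<Sum>u\<in>e. \<phi> u)) / real (b v))
     in (e # S, \<lambda>v. if v \<in> e then \<phi> v + w v else \<phi> v))"

definition msbm_step ::
    "('v set set \<Rightarrow> real) \<Rightarrow> ('v \<Rightarrow> nat) \<Rightarrow> 'v set list \<Rightarrow> real \<Rightarrow> real \<Rightarrow> 'v set \<Rightarrow> 'v msbm_state \<Rightarrow>
       'v msbm_state pmf" where
  "msbm_step f b es C q e = (\<lambda>(S, \<phi>).
     if C * (\<Sum>v\<in>e. \<phi> v) \<ge> stream_marginal f es e (set S) then return_pmf (S, \<phi>)
     else map_pmf (\<lambda>push. if push then msbm_push f b es e (S, \<phi>) else (S, \<phi>)) (bernoulli_pmf q))"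

text \<open>
  The distribution of the state after the first \<open>t\<close> edges; the \<open>t\<close>-th arriving edge is \<open>es ! (t - 1)\<close>.
\<close>

primrec msbm_stream ::
    "('v set set \<Rightarrow> real) \<Rightarrow> ('v \<Rightarrow> nat) \<Rightarrow> 'v set list \<Rightarrow> real \<Rightarrow> real \<Rightarrow> nat \<Rightarrow> 'v msbm_state pmf"
  where
  "msbm_stream f b es C q 0 = return_pmf ([], \<lambda>_. 0)"
| "msbm_stream f b es C q (Suc t) =
     bind_pmf (msbm_stream f b es C q t) (msbm_step f b es C q (es ! t))"

primrec msbm_unwind :: "('v \<Rightarrow> nat) \<Rightarrow> 'v set list \<Rightarrow> 'v set set \<Rightarrow> 'v set set" where
  "msbm_unwind b [] M = M"
| "msbm_unwind b (e # S) M =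
     msbm_unwind b S (if \<forall>v\<in>e. edge_degree M v < b v then M \<union> {e} else M)"

definition msbm ::
    "('v set set \<Rightarrow> real) \<Rightarrow> ('v \<Rightarrow> nat) \<Rightarrow> 'v set list \<Rightarrow> real \<Rightarrow> real \<Rightarrow> 'v set set pmf" where
  "msbm f b es C q =
     map_pmf (\<lambda>(S, \<phi>). msbm_unwind b S {}) (msbm_stream f b es C q (length es))"

end

theory Submission
  imports Defs
begin

text \<open>
  Call \<open>g\<^sub>e = f(e : S) - (\<Sum>u\<in>e. \<phi> u)\<close> the gain of a pushed edge and let \<open>W\<close> be the total gain.
  The push condition gives \<open>f(e : S) \<le> C / (C - 1) * g\<^sub>e\<close>, so \<open>f(S) \<le> f({}) + C / (C - 1) * W\<close>.
  Every skipped edge of \<open>OPT\<close> has marginal at most \<open>C\<close> times its final potential, and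
  \<open>(\<Sum>v. b v * \<phi> v) = 2 * W\<close>, so \<open>f(OPT) \<le> f(S) + 2 * C * W\<close>.
  Finally \<open>W \<le> f(M) - f({})\<close>: an edge \<open>e\<close> of the stack that is not put into \<open>M\<close> has an endpoint \<open>v\<close>
  carrying \<open>b v\<close> later edges of \<open>M\<close>, each of which saw the share \<open>g\<^sub>e / b v\<close> in the potential of \<open>v\<close>.
\<close>

section \<open>Submodular functions and degrees\<close>

lemma submodular_onD:
  assumes "submodular_on E f" "S \<subseteq> T" "T \<subseteq> E" "e \<in> E" "e \<notin> T"
  shows "marginal f T e \<le> marginal f S e"
  using assms unfolding submodular_on_def by blast

lemma submodular_on_union_le:
  assumes "submodular_on E f" "finite B" "A \<subseteq> E" "B \<subseteq> E" "A \<inter> B = {}"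
  shows "f (A \<union> B) \<le> f A + (\<Sum>e\<in>B. marginal f A e)"
  using assms(2,4,5)
proof (induction B rule: finite_induct)
  case (insert e B)
  have "marginal f (A \<union> B) e \<le> marginal f A e"
    using insert assms(3) by (intro submodular_onD[OF assms(1)]) auto
  then show ?case
    using insert by (simp add: marginal_def)
qed simp

lemma edge_degree_empty [simp]: "edge_degree {} v = 0"
  by (simp add: edge_degree_def)

lemma edge_degree_insert:
  assumes "finite M" "e \<notin> M"
  shows "edge_degree (insert e M) v = edge_degree M v + (if v \<in> e then 1 else 0)"
proof -
  have "{e' \<in> insert e M. v \<in> e'} =
      (if v \<in> e then insert e {e' \<in> M. v \<in> e'} else {e' \<in> M. v \<in> e'})"
    by auto
  then show ?thesis
    using assms by (simp add: edge_degree_def)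
qed

lemma sum_edge_degree_insert:
  fixes \<phi> :: "'v \<Rightarrow> real"
  assumes "finite V" "finite M" "e \<notin> M" "e \<subseteq> V"
  shows "(\<Sum>v\<in>V. real (edge_degree (insert e M) v) * \<phi> v)
    = (\<Sum>v\<in>V. real (edge_degree M v) * \<phi> v) + sum \<phi> e"
proof -
  have "(\<Sum>v\<in>V. real (edge_degree (insert e M) v) * \<phi> v)
      = (\<Sum>v\<in>V. real (edge_degree M v) * \<phi> v + (if v \<in> e then \<phi> v else 0))"
    by (intro sum.cong) (auto simp: edge_degree_insert[OF assms(2,3)] algebra_simps)
  also have "\<dots> = (\<Sum>v\<in>V. real (edge_degree M v) * \<phi> v) + sum \<phi> e"
    using assms(1,4) by (simp add: sum.distrib sum.If_cases Int_absorb1)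
  finally show ?thesis .
qed

text \<open>Double counting of incidences; it turns the potentials charged to the edges of a
  \<open>b\<close>-matching into a vertex sum to which the degree bounds apply.\<close>

lemma sum_over_edges_eq_sum_edge_degree:
  fixes \<phi> :: "'v \<Rightarrow> real"
  assumes "finite V" "finite M" "\<forall>e\<in>M. e \<subseteq> V"
  shows "(\<Sum>e\<in>M. sum \<phi> e) = (\<Sum>v\<in>V. real (edge_degree M v) * \<phi> v)"
  using assms(2,3)
  by (induction M rule: finite_induct) (simp_all add: sum_edge_degree_insert[OF assms(1)])

section \<open>Unwinding the stack\<close>

lemma msbm_unwind_superset: "M \<subseteq> msbm_unwind b S M"
  by (induction S arbitrary: M) (simp, force)

lemma msbm_unwind_subset: "msbm_unwind b S M \<subseteq> M \<union> set S"
proof (induction S arbitrary: M)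
  case (Cons e S)
  then show ?case using Cons.IH[of M] Cons.IH[of "insert e M"] by auto
qed simp

text \<open>The capacity test is strict, so an accepted edge raises the degree of each endpoint by
  at most one and stays within \<open>b\<close>.\<close>

lemma edge_degree_msbm_unwind_le:
  assumes "finite M" "\<forall>v\<in>V. edge_degree M v \<le> b v"
  shows "\<forall>v\<in>V. edge_degree (msbm_unwind b S M) v \<le> b v"
  using assms
proof (induction S arbitrary: M)
  case (Cons e S)
  show ?case
  proof (cases "\<forall>v\<in>e. edge_degree M v < b v")
    case True
    have "\<forall>v\<in>V. edge_degree (insert e M) v \<le> b v"
    proof
      fix v assume "v \<in> V"
      with True Cons.prems show "edge_degree (insert e M) v \<le> b v"
        by (cases "e \<in> M") (auto simp: insert_absorb edge_degree_insert Suc_le_eq)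
    qed
    then show ?thesis
      using Cons.IH[of "insert e M"] Cons.prems True by simp
  qed (use Cons in auto)
qed simp

section \<open>Deterministic runs\<close>

text \<open>This is \<open>b v * w v\<close> for the weight \<open>w\<close> of a push, hence the
  same number at both endpoints.\<close>

definition gain :: "('v set set \<Rightarrow> real) \<Rightarrow> 'v set list \<Rightarrow> ('v \<Rightarrow> real) \<Rightarrow> 'v set \<Rightarrow> real" where
  "gain f S \<phi> e = marginal f (set S) e - sum \<phi> e"

text \<open>\<open>P\<close> is the set of edges that have arrived so far and \<open>W\<close> is the total gain of the stack.\<close>

inductive msbm_run ::
    "'v set set \<Rightarrow> ('v \<Rightarrow> nat) \<Rightarrow> ('v set set \<Rightarrow> real) \<Rightarrow> real \<Rightarrow>
       'v set set \<Rightarrow> 'v set list \<Rightarrow> ('v \<Rightarrow> real) \<Rightarrow> real \<Rightarrow> bool"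
  for E b f C where
  init: "msbm_run E b f C {} [] (\<lambda>_. 0) 0"
| skip: "msbm_run E b f C P S \<phi> W \<Longrightarrow> e \<in> E - P \<Longrightarrow> marginal f (set S) e \<le> C * sum \<phi> e \<Longrightarrow>
    msbm_run E b f C (insert e P) S \<phi> W"
| push: "msbm_run E b f C P S \<phi> W \<Longrightarrow> e \<in> E - P \<Longrightarrow> C * sum \<phi> e < marginal f (set S) e \<Longrightarrow>
    msbm_run E b f C (insert e P) (e # S)
      (\<lambda>v. if v \<in> e then \<phi> v + gain f S \<phi> e / real (b v) else \<phi> v) (W + gain f S \<phi> e)"

text \<open>For \<open>q = 1\<close> the only randomness is a coin that always says push, so every
  state in the support comes from a deterministic run.\<close>

lemma msbm_stream_imp_run:
  assumes "distinct es" "set es = E" "t \<le> length es" "(S, \<phi>) \<in> set_pmf (msbm_stream f b es C 1 t)"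
  shows "set S \<subseteq> set (take t es) \<and> (\<exists>W. msbm_run E b f C (set (take t es)) S \<phi> W)"
  using assms(3,4)
proof (induction t arbitrary: S \<phi>)
  case 0
  then show ?case by (auto intro: msbm_run.init)
next
  case (Suc t)
  let ?e = "es ! t" and ?P = "set (take t es)"
  obtain S' \<phi>' where st: "(S', \<phi>') \<in> set_pmf (msbm_stream f b es C 1 t)"
    and step: "(S, \<phi>) \<in> set_pmf (msbm_step f b es C 1 ?e (S', \<phi>'))"
    using Suc.prems(2) by auto
  obtain W where sub: "set S' \<subseteq> ?P" and run: "msbm_run E b f C ?P S' \<phi>' W"
    using Suc.IH[OF _ st] Suc.prems(1) by auto
  have t: "t < length es" using Suc.prems(1) by simp
  have take: "set (take (Suc t) es) = insert ?e ?P"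
    using t by (simp add: take_Suc_conv_app_nth)
  have e: "?e \<in> E - ?P"
    using t assms(1,2) by (auto simp: in_set_conv_nth nth_eq_iff_index_eq)
  have before: "arrives_before es e' ?e" if "e' \<in> ?P" for e'
    using that t unfolding arrives_before_def in_set_conv_nth
    by (metis length_take min.absorb4 nth_take)
  \<comment> \<open>The stack holds only edges that arrived earlier, so restricting it to them
    changes nothing.\<close>
  have sm: "stream_marginal f es ?e (set S') = marginal f (set S') ?e"
    unfolding stream_marginal_def using sub before
    by (intro arg_cong[where f = "\<lambda>A. marginal f A ?e"]) auto
  show ?case
  proof (cases "marginal f (set S') ?e \<le> C * sum \<phi>' ?e")
    case True
    then have "S = S'" "\<phi> = \<phi>'"
      using step sm by (auto simp: msbm_step_def)
    then show ?thesis
      using msbm_run.skip[OF run e True] sub take by auto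
  next
    case False
    then have "(S, \<phi>) = msbm_push f b es ?e (S', \<phi>')"
      using step sm by (auto simp: msbm_step_def set_pmf_iff split: if_splits)
    then have "S = ?e # S'"
      "\<phi> = (\<lambda>v. if v \<in> ?e then \<phi>' v + gain f S' \<phi>' ?e / real (b v) else \<phi>' v)"
      by (simp_all add: msbm_push_def sm gain_def Let_def cong: if_cong)
    then show ?thesis
      using msbm_run.push[OF run e] False sub take by auto
  qed
qed

section \<open>Invariants of the streaming phase\<close>

locale msbm_instance =
  fixes V :: "'v set" and E :: "'v set set" and b :: "'v \<Rightarrow> nat" and f :: "'v set set \<Rightarrow> real"
    and C :: real
  assumes graph: "simple_graph V E"
    and b_pos: "\<And>v. v \<in> V \<Longrightarrow> b v > 0"
    and mono: "mono_on (Pow E) f"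
    and submod: "submodular_on E f"
    and C_gt_1: "C > 1"
begin

lemma finite_V: "finite V" and edge_subset: "e \<in> E \<Longrightarrow> e \<subseteq> V"
  and card_edge: "e \<in> E \<Longrightarrow> card e = 2"
  using graph by (auto simp: simple_graph_def)

lemma finite_E: "finite E"
  using finite_V edge_subset by (meson PowI finite_Pow_iff finite_subset subsetI)

lemma f_mono: "A \<subseteq> B \<Longrightarrow> B \<subseteq> E \<Longrightarrow> f A \<le> f B"
  using mono by (auto intro: mono_onD)

lemma run_stack_subset: "msbm_run E b f C P S \<phi> W \<Longrightarrow> set S \<subseteq> P \<and> P \<subseteq> E"
  by (induction rule: msbm_run.induct) auto

text \<open>The push condition makes \<open>sum \<phi> e\<close> less than a fraction
  \<open>1 / C\<close> of the marginal, so the gain keeps more than a fraction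
  \<open>1 - 1 / C\<close> of it.\<close>

lemma gain_bounds:
  assumes "\<And>v. 0 \<le> \<phi> v" "C * sum \<phi> e < marginal f (set S) e"
  shows "0 \<le> gain f S \<phi> e" "marginal f (set S) e \<le> C / (C - 1) * gain f S \<phi> e"
proof -
  have "0 \<le> sum \<phi> e" using assms(1) by (simp add: sum_nonneg)
  then have "sum \<phi> e \<le> C * sum \<phi> e" using C_gt_1 by (simp add: mult_le_cancel_right1)
  then show "0 \<le> gain f S \<phi> e" using assms(2) by (simp add: gain_def)
  show "marginal f (set S) e \<le> C / (C - 1) * gain f S \<phi> e"
    using assms(2) C_gt_1 by (simp add: gain_def field_simps)
qed

lemma run_potential_nonneg: "msbm_run E b f C P S \<phi> W \<Longrightarrow> 0 \<le> \<phi> v"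
proof (induction arbitrary: v rule: msbm_run.induct)
  case (push P S \<phi> W e)
  then show ?case using gain_bounds(1)[of \<phi> e S] by simp
qed auto

lemma run_gain_nonneg:
  assumes "msbm_run E b f C P S \<phi> W" "C * sum \<phi> e < marginal f (set S) e"
  shows "0 \<le> gain f S \<phi> e"
  using gain_bounds(1) run_potential_nonneg[OF assms(1)] assms(2) .

lemma run_stack_value_le: "msbm_run E b f C P S \<phi> W \<Longrightarrow> f (set S) \<le> f {} + C / (C - 1) * W"
proof (induction rule: msbm_run.induct)
  case (push P S \<phi> W e)
  have "marginal f (set S) e \<le> C / (C - 1) * gain f S \<phi> e"
    using gain_bounds(2) run_potential_nonneg[OF push.hyps(1)] push.hyps(3) .
  then show ?case using push.IH by (simp add: marginal_def distrib_left)
qed auto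

text \<open>A push adds \<open>gain / b v\<close> at each of the two endpoints; the weight
  \<open>b v\<close> cancels the division, so the sum grows by twice the gain.\<close>

lemma run_weighted_potential: "msbm_run E b f C P S \<phi> W \<Longrightarrow> (\<Sum>v\<in>V. real (b v) * \<phi> v) = 2 * W"
proof (induction rule: msbm_run.induct)
  case (push P S \<phi> W e)
  let ?g = "gain f S \<phi> e"
  have e: "e \<subseteq> V" "card e = 2" using push.hyps edge_subset card_edge by auto
  have "(\<Sum>v\<in>V. real (b v) * (if v \<in> e then \<phi> v + ?g / real (b v) else \<phi> v))
      = (\<Sum>v\<in>V. real (b v) * \<phi> v + (if v \<in> e then ?g else 0))"
    using b_pos by (intro sum.cong) (auto simp: field_simps)
  also have "\<dots> = 2 * W + 2 * ?g"
    using push.IH finite_V e by (simp add: sum.distrib sum.If_cases Int_absorb1)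
  finally show ?case by simp
qed auto

text \<open>The inequality holds when the edge is skipped and persists: as the stack grows,
  marginals shrink by submodularity while potentials only increase.\<close>

lemma run_skipped_edge:
  "msbm_run E b f C P S \<phi> W \<Longrightarrow> e' \<in> P - set S \<Longrightarrow> marginal f (set S) e' \<le> C * sum \<phi> e'"
proof (induction rule: msbm_run.induct)
  case (push P S \<phi> W e)
  let ?\<psi> = "\<lambda>v. if v \<in> e then \<phi> v + gain f S \<phi> e / real (b v) else \<phi> v"
  have sub: "set S \<subseteq> P" "P \<subseteq> E" using run_stack_subset[OF push.hyps(1)] by auto
  have "marginal f (set (e # S)) e' \<le> marginal f (set S) e'"
    using sub push.hyps push.prems by (intro submodular_onD[OF submod]) auto
  also have "\<dots> \<le> C * sum \<phi> e'" using push.IH push.prems by auto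
  also have "\<dots> \<le> C * sum ?\<psi> e'"
    using run_gain_nonneg[OF push.hyps(1,3)] C_gt_1 by (intro mult_left_mono sum_mono) auto
  finally show ?case .
qed auto

section \<open>Charging blocked edges to potentials\<close>

text \<open>
  The accumulator \<open>M\<^sub>0\<close> stands for the edges selected before the stack \<open>S\<close> is reached; the potential
  they see at \<open>S\<close> pays for the edges of \<open>S\<close> that they block.
\<close>

lemma run_total_gain_le_unwind_acc:
  assumes "msbm_run E b f C P S \<phi> W" "M\<^sub>0 \<subseteq> E - set S"
  shows "W \<le> f (msbm_unwind b S M\<^sub>0 \<inter> set S) - f {} + (\<Sum>v\<in>V. real (edge_degree M\<^sub>0 v) * \<phi> v)"
  using assms
proof (induction arbitrary: M\<^sub>0 rule: msbm_run.induct)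
  case (push P S \<phi> W e)
  let ?g = "gain f S \<phi> e"
  let ?\<psi> = "\<lambda>v. if v \<in> e then \<phi> v + ?g / real (b v) else \<phi> v"
  have sub: "set S \<subseteq> P" "P \<subseteq> E" using run_stack_subset[OF push.hyps(1)] by auto
  have e: "e \<in> E" "e \<notin> set S" "e \<subseteq> V" using push.hyps sub edge_subset by auto
  have fin: "finite M\<^sub>0" using push.prems finite_E finite_subset by blast
  have g: "0 \<le> ?g" using run_gain_nonneg[OF push.hyps(1,3)] .
  have le: "real (edge_degree M\<^sub>0 v) * \<phi> v \<le> real (edge_degree M\<^sub>0 v) * ?\<psi> v" for v
    using g by (intro mult_left_mono) auto
  show ?case
  proof (cases "\<forall>v\<in>e. edge_degree M\<^sub>0 v < b v")
    case True
    let ?M = "msbm_unwind b S (insert e M\<^sub>0)"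
    have IH: "W \<le> f (?M \<inter> set S) - f {} + (\<Sum>v\<in>V. real (edge_degree (insert e M\<^sub>0) v) * \<phi> v)"
      using push.IH[of "insert e M\<^sub>0"] push.prems e by auto
    have "e \<in> ?M" using msbm_unwind_superset by blast
    then have "?M \<inter> set (e # S) = (?M \<inter> set S) \<union> {e}" by auto
    then have "f (?M \<inter> set (e # S)) = f (?M \<inter> set S) + marginal f (?M \<inter> set S) e"
      by (simp add: marginal_def)
    \<comment> \<open>The marginal over the whole stack is \<open>gain + sum \<phi> e\<close>. The
      gain covers the growth of \<open>W\<close>, and \<open>sum \<phi> e\<close> pays for the
      larger degrees in the induction hypothesis.\<close>
    moreover have "marginal f (set S) e \<le> marginal f (?M \<inter> set S) e"
      using e sub by (intro submodular_onD[OF submod]) auto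
    moreover have "(\<Sum>v\<in>V. real (edge_degree (insert e M\<^sub>0) v) * \<phi> v)
        = (\<Sum>v\<in>V. real (edge_degree M\<^sub>0 v) * \<phi> v) + sum \<phi> e"
      using push.prems e fin finite_V by (intro sum_edge_degree_insert) auto
    moreover have "(\<Sum>v\<in>V. real (edge_degree M\<^sub>0 v) * \<phi> v)
        \<le> (\<Sum>v\<in>V. real (edge_degree M\<^sub>0 v) * ?\<psi> v)"
      by (intro sum_mono le)
    moreover have "msbm_unwind b (e # S) M\<^sub>0 = ?M" using True by simp
    ultimately show ?thesis using IH by (simp only: gain_def)
  next
    case False
    then obtain v where v: "v \<in> e" "b v \<le> edge_degree M\<^sub>0 v" by force
    then have vV: "v \<in> V" "0 < b v" using e b_pos by auto
    let ?M = "msbm_unwind b S M\<^sub>0"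
    have IH: "W \<le> f (?M \<inter> set S) - f {} + (\<Sum>v\<in>V. real (edge_degree M\<^sub>0 v) * \<phi> v)"
      using push.IH[of M\<^sub>0] push.prems by auto
    have "e \<notin> ?M" using msbm_unwind_subset[of b S M\<^sub>0] e push.prems by auto
    then have eq: "msbm_unwind b (e # S) M\<^sub>0 \<inter> set (e # S) = ?M \<inter> set S" using False by auto
    \<comment> \<open>The vertex \<open>v\<close> is saturated: its potential rises by
      \<open>?g / b v\<close> and is counted at least \<open>b v\<close> times, which pays for the
      whole gain of the rejected edge.\<close>
    have "?g = real (b v) * (?g / real (b v))" using vV by simp
    also have "\<dots> \<le> real (edge_degree M\<^sub>0 v) * (?g / real (b v))"
      using v g by (intro mult_right_mono) auto
    also have "\<dots> = real (edge_degree M\<^sub>0 v) * ?\<psi> v - real (edge_degree M\<^sub>0 v) * \<phi> v"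
      using v by (simp add: distrib_left)
    also have "\<dots> \<le> (\<Sum>v\<in>V. real (edge_degree M\<^sub>0 v) * ?\<psi> v - real (edge_degree M\<^sub>0 v) * \<phi> v)"
      using vV(1) finite_V le by (intro member_le_sum) auto
    finally show ?thesis using IH unfolding eq sum_subtractf by linarith
  qed
qed auto

lemma run_total_gain_le_unwind:
  assumes "msbm_run E b f C P S \<phi> W"
  shows "W \<le> f (msbm_unwind b S {}) - f {}"
proof -
  have "msbm_unwind b S {} \<inter> set S = msbm_unwind b S {}"
    using msbm_unwind_subset[of b S "{}"] by auto
  then show ?thesis using run_total_gain_le_unwind_acc[OF assms, of "{}"] by simp
qed

section \<open>Comparison with an arbitrary \<open>b\<close>-matching\<close>

lemma run_b_matching_value_le:
  assumes run: "msbm_run E b f C E S \<phi> W" and N: "b_matching V E b N"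
  shows "f N \<le> f (set S) + 2 * C * W"
proof -
  have sub: "set S \<subseteq> E" using run_stack_subset[OF run] by auto
  have NE: "N \<subseteq> E" "finite N" using N finite_E finite_subset by (auto simp: b_matching_def)
  have nn: "0 \<le> sum \<phi> e" for e using run_potential_nonneg[OF run] by (simp add: sum_nonneg)
  have "f N \<le> f (set S \<union> (N - set S))"
    using NE sub by (intro f_mono) auto
  also have "\<dots> \<le> f (set S) + (\<Sum>e\<in>N - set S. marginal f (set S) e)"
    using NE sub by (intro submodular_on_union_le[OF submod]) auto
  also have "(\<Sum>e\<in>N - set S. marginal f (set S) e) \<le> (\<Sum>e\<in>N - set S. C * sum \<phi> e)"
    using NE by (intro sum_mono run_skipped_edge[OF run]) auto
  \<comment> \<open>Nonnegative terms are added back so that the sum ranges over all of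
    \<open>N\<close>, whose degrees are at most \<open>b\<close>.\<close>
  also have "\<dots> \<le> (\<Sum>e\<in>N. C * sum \<phi> e)"
    using NE nn C_gt_1 by (intro sum_mono2) auto
  also have "\<dots> = C * (\<Sum>v\<in>V. real (edge_degree N v) * \<phi> v)"
    using NE finite_V edge_subset
    by (subst sum_over_edges_eq_sum_edge_degree[symmetric]) (auto simp: sum_distrib_left)
  also have "\<dots> \<le> C * (\<Sum>v\<in>V. real (b v) * \<phi> v)"
    using N C_gt_1 run_potential_nonneg[OF run]
    by (intro mult_left_mono sum_mono mult_right_mono) (auto simp: b_matching_def)
  finally show ?thesis by (simp add: run_weighted_potential[OF run])
qed

theorem msbm_approximation:
  assumes "edge_stream E es" "0 \<le> f {}" "b_matching V E b N" "M \<in> set_pmf (msbm f b es C 1)"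
  shows "b_matching V E b M \<and> f N \<le> (2 * C + C / (C - 1)) * f M"
proof -
  obtain S \<phi> where st: "(S, \<phi>) \<in> set_pmf (msbm_stream f b es C 1 (length es))"
    and M: "M = msbm_unwind b S {}"
    using assms(4) by (auto simp: msbm_def)
  have es: "distinct es" "set es = E" using assms(1) by (auto simp: edge_stream_def)
  obtain W where run: "msbm_run E b f C E S \<phi> W"
    using msbm_stream_imp_run[OF es order_refl st] es by auto
  have "M \<subseteq> E"
    using msbm_unwind_subset[of b S "{}"] run_stack_subset[OF run] M by auto
  moreover have "\<forall>v\<in>V. edge_degree M v \<le> b v"
    unfolding M by (rule edge_degree_msbm_unwind_le) auto
  moreover have "f N \<le> (2 * C + C / (C - 1)) * f M"
  proof -
    let ?K = "2 * C + C / (C - 1)"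
    have K: "1 \<le> ?K" using C_gt_1 by (intro add_increasing2) auto
    have "f N \<le> f {} + ?K * W"
      using run_b_matching_value_le[OF run assms(3)] run_stack_value_le[OF run]
      by (simp add: distrib_right)
    \<comment> \<open>The value \<open>f {}\<close> may be positive; since \<open>?K\<close> is at
      least 1, enlarging it to \<open>?K * f {}\<close> cancels the loss in
      \<open>f M - f {}\<close>.\<close>
    also have "\<dots> \<le> ?K * f {} + ?K * (f M - f {})"
      using K assms(2) run_total_gain_le_unwind[OF run] M
      by (intro add_mono mult_left_mono) (auto simp: mult_le_cancel_right1)
    finally show ?thesis by (simp add: right_diff_distrib)
  qed
  ultimately show ?thesis by (simp add: b_matching_def)
qed

end

theorem theorem4p1:
  fixes V :: "'v set" and E :: "'v set set" and es :: "'v set list"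
    and b :: "'v \<Rightarrow> nat" and f :: "'v set set \<Rightarrow> real" and OPT :: "'v set set"
  assumes "simple_graph V E"
    and "\<forall>v\<in>V. b v > 0"
    and "edge_stream E es"
    and "\<forall>A\<subseteq>E. f A \<ge> 0"
    and "mono_on (Pow E) f"
    and "submodular_on E f"
    and "max_b_matching f V E b OPT"
  shows "(\<forall>C>1. \<forall>M\<in>set_pmf (msbm f b es C 1).
            b_matching V E b M \<and> (2 * C + C / (C - 1)) * f M \<ge> f OPT)
       \<and> (\<forall>M\<in>set_pmf (msbm f b es (1 + 1 / sqrt 2) 1).
            b_matching V E b M \<and> (3 + 2 * sqrt 2) * f M \<ge> f OPT)
       \<and> \<bar>3 + 2 * sqrt 2 - 5.828\<bar> < (0.0005 :: real)"
proof -
  have approx: "b_matching V E b M \<and> f OPT \<le> (2 * C + C / (C - 1)) * f M"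
    if "C > 1" "M \<in> set_pmf (msbm f b es C 1)" for C M
  proof -
    interpret msbm_instance V E b f C
      using assms that by unfold_locales auto
    show ?thesis
      using msbm_approximation[of es OPT M] assms(3,4,7) that(2) by (simp add: max_b_matching_def)
  qed
  let ?C = "1 + 1 / sqrt 2 :: real"
  \<comment> \<open>Here \<open>2 * ?C = 2 + sqrt 2\<close> and
    \<open>?C / (?C - 1) = 1 + sqrt 2\<close>. This choice minimises the factor over
    \<open>C > 1\<close>, as its derivative \<open>2 - 1 / (C - 1)^2\<close> vanishes there.\<close>
  have "2 * ?C + ?C / (?C - 1) = 3 + 2 * sqrt 2"
    by (simp add: field_simps)
  moreover have "?C > 1" by simp
  ultimately have "\<forall>M\<in>set_pmf (msbm f b es ?C 1).
      b_matching V E b M \<and> f OPT \<le> (3 + 2 * sqrt 2) * f M"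
    using approx[of ?C] by metis
  \<comment> \<open>These bounds place \<open>3 + 2 * sqrt 2\<close> strictly between 5.828 and
    5.8285.\<close>
  moreover have "1.414 < sqrt 2" "sqrt 2 < 1.41425"
    by (rule real_less_rsqrt real_less_lsqrt; simp add: power2_eq_square)+
  ultimately show ?thesis
    using approx by (auto simp: abs_less_iff)
qed

end
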